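(* Let $p$ be a prime, $n,m\ge1$ integers, and $F,G:\mathbb{F}_{p^n}\to\mathbb{F}_{p^m}$. If $F$ and $G$ are EA-equivalent, then the multiset $$\{L_F(u,v;j):u\in\mathbb{F}_{p^n}^*,\ v\in\mathbb{F}_{p^m}^*,\ j\in\mathbb{F}_p\}$$ is the same for $F$ and $G$. In particular, $\Gamma_G^{(p)}=\Gamma_F^{(p)}$. If $F$ and $G$ are affine equivalent, then each profile is preserved after reindexing the input and output masks, without a level translation: with $G=B\circ F\circ A$, where $A$ and $B$ are affine permutations with linear parts $A_0$ and $B_0$, one has $L_G(u,v;j)=L_F(A_0(u),B_0^*(v);j)$ for all $u\in\mathbb{F}_{p^n}$, $v\in\mathbb{F}_{p^m}$, $j\in\mathbb{F}_p$. In particular, affine-equivalent functions also satisfy $\gamma_G^{(p,0)}=\gamma_F^{(p,0)}$.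
   Context: $\mathrm{Tr}_1^m$ is the absolute trace $\mathbb{F}_{p^m}\to\mathbb{F}_p$; a superscript $*$ on a field denotes its nonzero elements. Affine and linear are over $\mathbb{F}_p$. Two functions $F,G:\mathbb{F}_{p^n}\to\mathbb{F}_{p^m}$ are EA-equivalent if $G=B\circ F\circ A+C$ for some affine permutations $A$ of $\mathbb{F}_{p^n}$ and $B$ of $\mathbb{F}_{p^m}$ and some affine map $C:\mathbb{F}_{p^n}\to\mathbb{F}_{p^m}$; they are affine equivalent when one may take $C=0$. For an invertible $\mathbb{F}_p$-linear map $B_0$ of $\mathbb{F}_{p^m}$, the adjoint $B_0^*$ is characterized by $\mathrm{Tr}_1^m(vB_0(y))=\mathrm{Tr}_1^m(B_0^*(v)y)$ for all $v,y\in\mathbb{F}_{p^m}$. The derivative is $D_uF(x)=F(x+u)-F(x)$, and $L_F(u,v;j)=\#\{x\in\mathbb{F}_{p^n}:\mathrm{Tr}_1^m(vD_uF(x))=j\}-p^{n-1}$. The parameters are $\Gamma_F^{(p)}=\max_{u\in\mathbb{F}_{p^n}^*,\,v\in\mathbb{F}_{p^m}^*,\,j\in\mathbb{F}_p}|L_F(u,v;j)|$ and $\gamma_F^{(p,0)}=\max_{u\in\mathbb{F}_{p^n}^*,\,v\in\mathbb{F}_{p^m}^*}|L_F(u,v;0)|$. *)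

theory Defs
  imports
    "HOL-Library.Multiset"
    "HOL-Library.Cardinality"
    "HOL-Computational_Algebra.Computational_Algebra"
begin

(* A finite field of order p^k is a type of class {field, finite} whose cardinality is p^k.
   Its prime subfield F_p is the set \<int> = range of_int, and the copies of F_p inside two
   fields of the same characteristic p correspond through of_int. *)

abbreviation prime_subfield :: "'a::ring_1 set"
  where "prime_subfield \<equiv> \<int>"

(* The absolute trace from F_{p^m} to F_p, with values in the prime subfield of F_{p^m}. *)
definition abs_trace :: "nat \<Rightarrow> nat \<Rightarrow> 'b::field \<Rightarrow> 'b"
  where "abs_trace p m y = (\<Sum>i<m. y ^ (p ^ i))"

(* F_p-linearity. The domain and the codomain are different types, so a scalar of F_p is given
   by an integer representative. *)
definition fp_linear :: "('a::field \<Rightarrow> 'b::field) \<Rightarrow> bool"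
  where "fp_linear f \<longleftrightarrow>
    (\<forall>x y. f (x + y) = f x + f y) \<and> (\<forall>(c::int) x. f (of_int c * x) = of_int c * f x)"

definition fp_affine_with_linear_part :: "('a::field \<Rightarrow> 'b::field) \<Rightarrow> ('a \<Rightarrow> 'b) \<Rightarrow> bool"
  where "fp_affine_with_linear_part f f0 \<longleftrightarrow> fp_linear f0 \<and> (\<exists>c. \<forall>x. f x = f0 x + c)"

definition fp_affine :: "('a::field \<Rightarrow> 'b::field) \<Rightarrow> bool"
  where "fp_affine f \<longleftrightarrow> (\<exists>f0. fp_affine_with_linear_part f f0)"

definition affine_permutation :: "('a::field \<Rightarrow> 'a) \<Rightarrow> bool"
  where "affine_permutation f \<longleftrightarrow> fp_affine f \<and> bij f"

definition EA_equivalent :: "('a::field \<Rightarrow> 'b::field) \<Rightarrow> ('a \<Rightarrow> 'b) \<Rightarrow> bool"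
  where "EA_equivalent F G \<longleftrightarrow>
    (\<exists>A B C. affine_permutation A \<and> affine_permutation B \<and> fp_affine C \<and>
       G = (\<lambda>x. (B \<circ> F \<circ> A) x + C x))"

definition affine_equivalent :: "('a::field \<Rightarrow> 'b::field) \<Rightarrow> ('a \<Rightarrow> 'b) \<Rightarrow> bool"
  where "affine_equivalent F G \<longleftrightarrow>
    (\<exists>A B. affine_permutation A \<and> affine_permutation B \<and> G = B \<circ> F \<circ> A)"

(* Meaningful for F_p-linear maps on a field of order p^m, where nondegeneracy of the trace
   form gives existence and uniqueness. *)
definition trace_adjoint :: "nat \<Rightarrow> nat \<Rightarrow> ('b::field \<Rightarrow> 'b) \<Rightarrow> 'b \<Rightarrow> 'b"
  where "trace_adjoint p m B0 =
    (THE B'. \<forall>v y. abs_trace p m (v * B0 y) = abs_trace p m (B' v * y))"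

definition derivative :: "('a::field \<Rightarrow> 'b::field) \<Rightarrow> 'a \<Rightarrow> 'a \<Rightarrow> 'b"
  where "derivative F u x = F (x + u) - F x"

definition L_dev ::
    "nat \<Rightarrow> nat \<Rightarrow> nat \<Rightarrow> ('a::field \<Rightarrow> 'b::field) \<Rightarrow> 'a \<Rightarrow> 'b \<Rightarrow> 'b \<Rightarrow> int"
  where "L_dev p n m F u v j =
    int (card {x. abs_trace p m (v * derivative F u x) = j}) - int (p ^ (n - 1))"

definition L_multiset ::
    "nat \<Rightarrow> nat \<Rightarrow> nat \<Rightarrow> ('a::{field,finite} \<Rightarrow> 'b::{field,finite}) \<Rightarrow> int multiset"
  where "L_multiset p n m F =
    image_mset (\<lambda>(u, v, j). L_dev p n m F u v j)
      (mset_set ((UNIV - {0}) \<times> (UNIV - {0}) \<times> prime_subfield))"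

definition Gamma_max ::
    "nat \<Rightarrow> nat \<Rightarrow> nat \<Rightarrow> ('a::{field,finite} \<Rightarrow> 'b::{field,finite}) \<Rightarrow> int"
  where "Gamma_max p n m F =
    Max ((\<lambda>(u, v, j). \<bar>L_dev p n m F u v j\<bar>) `
      ((UNIV - {0}) \<times> (UNIV - {0}) \<times> prime_subfield))"

definition gamma_zero_max ::
    "nat \<Rightarrow> nat \<Rightarrow> nat \<Rightarrow> ('a::{field,finite} \<Rightarrow> 'b::{field,finite}) \<Rightarrow> int"
  where "gamma_zero_max p n m F =
    Max ((\<lambda>(u, v). \<bar>L_dev p n m F u v 0\<bar>) ` ((UNIV - {0}) \<times> (UNIV - {0})))"

end

theory Submission
  imports Defs "HOL-Number_Theory.Cong"
begin

text \<open>
  If \<open>G = B \<circ> F \<circ> A + C\<close>, then \<open>D\<^sub>uG(x)\<close> is \<open>B\<^sub>0(D\<^sub>wF(A x)) + C\<^sub>0(u)\<close> with \<open>w = A\<^sub>0(u)\<close>, so moving \<open>B\<^sub>0\<close>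
  to the mask by adjunction shows that the profile of \<open>G\<close> at \<open>(u, v)\<close> is that of \<open>F\<close> at
  \<open>(A\<^sub>0(u), B\<^sub>0*(v))\<close>, with levels translated by the trace of \<open>v C\<^sub>0(u)\<close>. The adjoint exists because the
  trace form is nondegenerate (the trace is a nonzero polynomial of degree less than \<open>p^m\<close>) and
  there are at most \<open>p^m\<close> functionals.
\<close>

section \<open>Finite fields and linear maps over the prime field\<close>

lemma CHAR_eq_of_CARD_prime_power:
  assumes "prime p" and "CARD('b::{field,finite}) = p ^ m"
  shows "CHAR('b) = p"
proof -
  have "CHAR('b) > 0"
    by (rule finite_imp_CHAR_pos) simp
  then have "prime CHAR('b)"
    by (rule prime_CHAR_semidom)
  moreover have "CHAR('b) dvd p ^ m"
  proof -
    \<comment> \<open>Translation by \<open>1\<close> permutes the field, so the sum of all elements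
      absorbs \<open>CARD('b)\<close> copies of \<open>1\<close>.\<close>
    have "(\<Sum>x\<in>UNIV. x) = (\<Sum>x\<in>UNIV. x + (1::'b))"
      by (rule sum.reindex_bij_witness[of _ "\<lambda>x. x + 1" "\<lambda>x. x - 1"]) auto
    then have "of_nat CARD('b) = (0::'b)"
      by (simp add: sum.distrib)
    then show ?thesis
      by (metis assms(2) of_nat_eq_0_iff_char_dvd)
  qed
  ultimately show ?thesis
    using assms(1) prime_dvd_power primes_dvd_imp_eq by blast
qed

text \<open>Multiplication by a nonzero \<open>x\<close> permutes the nonzero elements; cancelling
  their product leaves \<open>x ^ (CARD('b) - 1) = 1\<close>.\<close>

lemma power_CARD_eq_self:
  fixes x :: "'b::{field,finite}"
  shows "x ^ CARD('b) = x"
proof (cases "x = 0")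
  case False
  let ?P = "\<Prod>y\<in>UNIV - {0::'b}. y"
  have "?P = (\<Prod>y\<in>UNIV - {0}. x * y)"
    by (rule prod.reindex_bij_witness[of _ "\<lambda>y. x * y" "\<lambda>y. y / x"]) (use False in auto)
  also have "\<dots> = x ^ (CARD('b) - 1) * ?P"
    by (simp add: prod.distrib card_Diff_subset)
  finally have "x ^ (CARD('b) - 1) = 1"
    by simp
  moreover have "CARD('b) = Suc (CARD('b) - 1)"
    by simp
  ultimately show ?thesis
    by (metis mult.right_neutral power_Suc)
qed simp

section \<open>Linear and affine maps over the prime field\<close>

lemma fp_linear_add: "fp_linear f \<Longrightarrow> f (x + y) = f x + f y"
  by (simp add: fp_linear_def)

lemma fp_linear_scale: "fp_linear f \<Longrightarrow> c \<in> \<int> \<Longrightarrow> f (c * x) = c * f x"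
  by (auto simp: fp_linear_def elim!: Ints_cases)

lemma fp_linear_zero: "fp_linear f \<Longrightarrow> f 0 = 0"
  by (metis add_cancel_left_right fp_linear_add)

lemma fp_linear_diff: "fp_linear f \<Longrightarrow> f (x - y) = f x - f y"
  using fp_linear_add[of f "x - y" y] by simp

lemma fp_affine_iff: "fp_affine f \<longleftrightarrow> (\<exists>f0 c. fp_linear f0 \<and> f = (\<lambda>x. f0 x + c))"
  unfolding fp_affine_def fp_affine_with_linear_part_def fun_eq_iff by blast

lemma bij_linear_part:
  assumes "bij (f :: 'a::field \<Rightarrow> 'b::field)" and "\<And>x. f x = f0 x + c"
  shows "bij f0"
proof -
  have "f0 = (\<lambda>y. y - c) \<circ> f"
    using assms(2) by auto
  moreover have "bij (\<lambda>y. y - c)"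
    by (rule bij_betw_byWitness[where f' = "\<lambda>y. y + c"]) auto
  ultimately show ?thesis
    using assms(1) bij_comp by metis
qed

section \<open>The prime subfield: its size and its description by Frobenius\<close>

lemma Ints_eq_of_nat_image: "(\<int> :: 'b::{field,finite} set) = of_nat ` {..<CHAR('b)}"
proof
  have pos: "CHAR('b) > 0"
    by (rule finite_imp_CHAR_pos) simp
  show "(\<int> :: 'b set) \<subseteq> of_nat ` {..<CHAR('b)}"
  proof
    fix x :: 'b
    assume "x \<in> \<int>"
    then obtain k where k: "x = of_int k"
      by (auto elim: Ints_cases)
    let ?r = "nat (k mod int CHAR('b))"
    have "x = of_int (int ?r)"
      using pos by (simp add: k of_int_eq_iff_cong_CHAR cong_def del: of_int_of_nat_eq)
    moreover have "?r < CHAR('b)"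
      using pos by (simp add: nat_less_iff)
    ultimately show "x \<in> of_nat ` {..<CHAR('b)}"
      by (metis image_eqI lessThan_iff of_int_of_nat_eq)
  qed
qed auto

lemma card_Ints_eq_CHAR: "card (\<int> :: 'b::{field,finite} set) = CHAR('b)"
proof -
  have "inj_on (of_nat :: nat \<Rightarrow> 'b) {..<CHAR('b)}"
    by (auto simp: inj_on_def of_nat_eq_iff_cong_CHAR cong_def)
  then show ?thesis
    by (simp add: Ints_eq_of_nat_image card_image)
qed

text \<open>With \<open>p\<close> the characteristic, the prime subfield consists of roots of
  \<open>X^p - X\<close> by Fermat's little theorem, proved by induction with the freshman's dream.
  It has \<open>p\<close> elements already, and the polynomial has at most \<open>p\<close>
  roots.\<close>

lemma power_CHAR_eq_self_iff_Ints:
  fixes x :: "'b::{field,finite}"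
  shows "x ^ CHAR('b) = x \<longleftrightarrow> x \<in> \<int>"
proof -
  let ?p = "CHAR('b)"
  have "?p > 0"
    by (rule finite_imp_CHAR_pos) simp
  then have prime: "prime ?p"
    by (rule prime_CHAR_semidom)
  then have p2: "?p \<ge> 2"
    by (rule prime_ge_2_nat)
  let ?R = "{x :: 'b. x ^ ?p = x}"
  have "of_nat k ^ ?p = (of_nat k :: 'b)" for k
  proof (induction k)
    case 0
    show ?case using p2 by simp
  next
    case (Suc k)
    then show ?case
      using freshmans_dream[OF _ refl, of "1 :: 'b" "of_nat k"] prime by simp
  qed
  then have sub: "\<int> \<subseteq> ?R"
    by (auto simp: Ints_eq_of_nat_image)
  define P :: "'b poly" where "P = monom 1 ?p - monom 1 1"
  have "coeff P ?p = 1"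
    using p2 by (simp add: P_def)
  then have "P \<noteq> 0"
    by auto
  have "?R = {x. poly P x = 0}"
    by (simp add: P_def poly_monom)
  then have "card ?R \<le> degree P"
    using card_poly_roots_bound[OF \<open>P \<noteq> 0\<close>] by simp
  also have "degree P \<le> ?p"
    unfolding P_def using p2 by (intro degree_diff_le degree_monom_le[THEN order_trans]) auto
  finally have "\<int> = ?R"
    using sub by (intro card_seteq) (auto simp: card_Ints_eq_CHAR)
  then show ?thesis
    by blast
qed

text \<open>
  Functionals are counted without bases: \<open>det E\<close> is the subspace on which a functional is determined
  by its values on \<open>E\<close>, and adding to \<open>E\<close> a point outside it multiplies its size by at least \<open>p\<close>.
\<close>

lemma card_functionals_le:
  "card {f :: 'b::{field,finite} \<Rightarrow> 'b. fp_linear f \<and> range f \<subseteq> \<int>} \<le> CARD('b)"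
proof -
  define p where "p = CHAR('b)"
  have cardZ: "card (\<int> :: 'b set) = p"
    by (simp add: p_def card_Ints_eq_CHAR)
  have fin: "finite A" for A :: "'b set"
    by simp
  let ?L = "{f :: 'b \<Rightarrow> 'b. fp_linear f \<and> range f \<subseteq> \<int>}"
  define det where
    "det E = {x. \<forall>f\<in>?L. \<forall>g\<in>?L. (\<forall>e\<in>E. f e = g e) \<longrightarrow> f x = g x}" for E
  \<comment> \<open>\<open>Q\<close> stands in for linear independence of \<open>E\<close>: it holds
    for the empty set and survives adjoining a point outside \<open>det E\<close>.\<close>
  define Q where "Q E \<longleftrightarrow> p ^ card E \<le> card (det E)" for E
  have detI: "x \<in> det E"
    if "\<And>f g. f \<in> ?L \<Longrightarrow> g \<in> ?L \<Longrightarrow> (\<And>e. e \<in> E \<Longrightarrow> f e = g e) \<Longrightarrow> f x = g x" for x E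
    unfolding det_def by (intro CollectI ballI impI, rule that) simp_all
  have detD: "f x = g x"
    if "x \<in> det E" "f \<in> ?L" "g \<in> ?L" "\<And>e. e \<in> E \<Longrightarrow> f e = g e" for x E f g
    using that(1)[unfolded det_def, THEN CollectD, rule_format, OF that(2-4)] .
  have "0 \<in> det {}"
    by (rule detI) (simp add: fp_linear_zero)
  then have "det {} \<noteq> {}"
    by blast
  then have "Q {}"
    by (simp add: Q_def Suc_le_eq card_gt_0_iff)
  have step: "Q (insert x E)" if E: "Q E" and x: "x \<notin> det E" for x E
  proof -
    \<comment> \<open>The points \<open>c * x + d\<close> are pairwise distinct and lie in
      \<open>det (insert x E)\<close>; the \<open>p\<close> choices of \<open>c\<close> give the
      factor \<open>p\<close>.\<close>
    have "inj_on (\<lambda>(c, d). c * x + d) (\<int> \<times> det E)"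
    proof (rule inj_onI, clarify)
      fix c d c' d'
      assume *: "c \<in> \<int>" "d \<in> det E" "c' \<in> \<int>" "d' \<in> det E" "c * x + d = c' * x + d'"
      \<comment> \<open>Otherwise \<open>(c - c') * x = d' - d\<close>, so values on
        \<open>det E\<close> would determine the value at \<open>x\<close>.\<close>
      have "c = c'"
      proof (rule ccontr)
        assume "c \<noteq> c'"
        have "x \<in> det E"
        proof (rule detI)
          fix f g
          assume fg: "f \<in> ?L" "g \<in> ?L" "\<And>e. e \<in> E \<Longrightarrow> f e = g e"
          have scale: "(c - c') * h x = h d' - h d" if "h \<in> ?L" for h
          proof -
            have "(c - c') * x = d' - d"
              using *(5) by (simp add: algebra_simps)
            moreover have "fp_linear h" "c - c' \<in> \<int>"
              using that *(1,3) by auto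
            ultimately show ?thesis
              by (metis fp_linear_scale fp_linear_diff)
          qed
          have "f d = g d" "f d' = g d'"
            using detD[OF *(2) fg(1,2)] detD[OF *(4) fg(1,2)] fg(3) by simp_all
          then have "(c - c') * f x = (c - c') * g x"
            using scale[OF fg(1)] scale[OF fg(2)] by simp
          then show "f x = g x"
            using \<open>c \<noteq> c'\<close> by simp
        qed
        with x show False ..
      qed
      with *(5) show "c = c' \<and> d = d'"
        by simp
    qed
    moreover have "(\<lambda>(c, d). c * x + d) ` (\<int> \<times> det E) \<subseteq> det (insert x E)"
    proof clarify
      fix c d :: 'b
      assume cd: "c \<in> \<int>" "d \<in> det E"
      show "c * x + d \<in> det (insert x E)"
      proof (rule detI)
        fix f g
        assume fg: "f \<in> ?L" "g \<in> ?L" "\<And>e. e \<in> insert x E \<Longrightarrow> f e = g e"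
        then have "f d = g d"
          using detD[OF cd(2) fg(1,2)] by simp
        then show "f (c * x + d) = g (c * x + d)"
          using fg cd(1) by (simp add: fp_linear_add fp_linear_scale)
      qed
    qed
    ultimately have "card ((\<int> :: 'b set) \<times> det E) \<le> card (det (insert x E))"
      by (rule card_inj_on_le) (rule fin)
    moreover have "x \<notin> E"
      using x detI[of E x] by auto
    moreover have "p * p ^ card E \<le> p * card (det E)"
      using E unfolding Q_def by (rule mult_le_mono2)
    ultimately show ?thesis
      unfolding Q_def card_insert_disjoint[OF fin \<open>x \<notin> E\<close>] power_Suc card_cartesian_product cardZ
      by linarith
  qed
  \<comment> \<open>Sizes of subsets are bounded, so some \<open>E\<close> with \<open>Q E\<close>
    is largest; by \<open>step\<close> no point can lie outside its \<open>det E\<close>.\<close>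
  have "card E' < Suc CARD('b)" for E' :: "'b set"
    by (simp add: card_mono le_imp_less_Suc)
  then have "\<exists>E. Q E \<and> (\<forall>E'. Q E' \<longrightarrow> card E' \<le> card E)"
    using \<open>Q {}\<close> ex_has_greatest_nat[of Q "{}" card "Suc CARD('b)"] by simp
  then obtain E where E: "Q E" and max: "\<And>E'. Q E' \<Longrightarrow> card E' \<le> card E"
    by auto
  have "det E = UNIV"
  proof (rule ccontr)
    assume "det E \<noteq> UNIV"
    then obtain x where x: "x \<notin> det E"
      by blast
    then have "x \<notin> E"
      using detI[of E x] by auto
    then show False
      using max[OF step[OF E x]] by (simp add: card_insert_disjoint[OF fin])
  qed
  \<comment> \<open>Since \<open>det E\<close> is everything, a functional is known from its
    restriction to \<open>E\<close>, and \<open>Q E\<close> bounds the number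
    \<open>p ^ card E\<close> of possible restrictions.\<close>
  have "inj_on (\<lambda>f. restrict f E) ?L"
  proof (rule inj_onI, rule ext)
    fix f g x
    assume fg: "f \<in> ?L" "g \<in> ?L" "restrict f E = restrict g E"
    have "x \<in> det E"
      by (simp add: \<open>det E = UNIV\<close>)
    then show "f x = g x"
      using fg(1,2)
    proof (rule detD)
      fix e
      assume "e \<in> E"
      then show "f e = g e"
        using fun_cong[OF fg(3), of e] by simp
    qed
  qed
  moreover have "(\<lambda>f. restrict f E) ` ?L \<subseteq> E \<rightarrow>\<^sub>E (\<int> :: 'b set)"
  proof (rule image_subsetI)
    fix f :: "'b \<Rightarrow> 'b"
    assume "f \<in> ?L"
    then show "restrict f E \<in> E \<rightarrow>\<^sub>E \<int>"
      by (auto simp: PiE_iff)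
  qed
  ultimately have "card ?L \<le> card (E \<rightarrow>\<^sub>E (\<int> :: 'b set))"
    by (rule card_inj_on_le) (simp add: finite_PiE)
  also have "\<dots> = p ^ card E"
    by (simp add: card_funcsetE cardZ)
  also have "\<dots> \<le> CARD('b)"
    using E by (simp add: Q_def \<open>det E = UNIV\<close>)
  finally show ?thesis .
qed

section \<open>The trace form and adjoints\<close>

text \<open>\<open>field_type\<close> names the codomain field, whose trace and adjoints are
  developed here.\<close>

locale finite_field_trace =
  fixes p m :: nat and field_type :: "'b::{field,finite} itself"
  assumes prime: "prime p" and CARD: "CARD('b) = p ^ m"
begin

abbreviation tr :: "'b \<Rightarrow> 'b" where "tr \<equiv> abs_trace p m"

lemma CHAR: "CHAR('b) = p"
  using CHAR_eq_of_CARD_prime_power[OF prime CARD] .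

lemma m_pos: "m > 0"
proof (rule ccontr)
  assume "\<not> m > 0"
  then have "CARD('b) = 1"
    using CARD by simp
  then have "(0::'b) = 1"
    by (metis (full_types) UNIV_I card_1_singletonE singletonD)
  then show False
    by simp
qed

lemma frobenius_add: "(x + y :: 'b) ^ (p ^ i) = x ^ (p ^ i) + y ^ (p ^ i)"
  by (rule freshmans_dream') (simp_all add: CHAR prime)

lemma frobenius_Ints: "c \<in> \<int> \<Longrightarrow> (c :: 'b) ^ (p ^ i) = c"
proof (induction i)
  case (Suc i)
  then show ?case
    using power_CHAR_eq_self_iff_Ints[of c] by (simp add: CHAR power_mult)
qed simp

lemma trace_linear: "fp_linear tr"
  by (simp add: fp_linear_def abs_trace_def frobenius_add sum.distrib power_mult_distrib
      frobenius_Ints sum_distrib_left)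

text \<open>Raising to the power \<open>p\<close> cyclically shifts the summands of the trace, so
  Frobenius fixes it.\<close>

lemma trace_in_Ints: "tr y \<in> \<int>"
proof -
  have "tr y ^ p = (\<Sum>i<m. y ^ (p ^ Suc i))"
    unfolding abs_trace_def
    by (subst freshmans_dream_sum) (simp_all add: CHAR prime mult.commute flip: power_mult)
  also have "\<dots> = tr y"
  proof -
    \<comment> \<open>The sum with one extra term is split off first at \<open>i = 0\<close> and
      then at \<open>i = m\<close>, where \<open>y ^ (p ^ m) = y\<close>.\<close>
    have "(\<Sum>i<m. y ^ (p ^ Suc i)) + y = (\<Sum>i<Suc m. y ^ (p ^ i))"
      by (simp add: sum.lessThan_Suc_shift add.commute del: sum.lessThan_Suc)
    also have "\<dots> = tr y + y"
      using power_CARD_eq_self[of y] by (simp add: abs_trace_def CARD)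
    finally show ?thesis by simp
  qed
  finally show ?thesis
    using power_CHAR_eq_self_iff_Ints[of "tr y"] by (simp add: CHAR)
qed

lemma trace_nonzero: "\<exists>y. tr y \<noteq> 0"
proof (rule ccontr)
  assume *: "\<nexists>y. tr y \<noteq> 0"
  define P :: "'b poly" where "P = (\<Sum>i<m. monom 1 (p ^ i))"
  have p2: "p \<ge> 2"
    using prime by (rule prime_ge_2_nat)
  \<comment> \<open>The exponent \<open>p ^ i\<close> equals \<open>1\<close> only for
    \<open>i = 0\<close>, an index that \<open>m_pos\<close> puts in range.\<close>
  have "coeff P 1 = (\<Sum>i<m. if i = 0 then 1 else 0)"
    unfolding P_def coeff_sum using p2 by (intro sum.cong) auto
  also have "\<dots> = 1"
    using m_pos by simp
  finally have "P \<noteq> 0"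
    by auto
  have "poly P y = tr y" for y
    by (simp add: P_def poly_sum poly_monom abs_trace_def)
  then have "CARD('b) \<le> degree P"
    using card_poly_roots_bound[OF \<open>P \<noteq> 0\<close>] * by simp
  moreover have "degree P \<le> p ^ (m - 1)"
    unfolding P_def using p2
    by (intro degree_sum_le) (auto intro!: order_trans[OF degree_monom_le] power_increasing)
  moreover have "p ^ (m - 1) < p ^ m"
    using p2 m_pos by (intro power_strict_increasing) auto
  ultimately show False
    using CARD by simp
qed

lemma trace_form_nondegenerate:
  assumes "\<And>y. tr (b * y) = tr (b' * y)"
  shows "b = b'"
proof (rule ccontr)
  assume "b \<noteq> b'"
  obtain y where "tr y \<noteq> 0"
    using trace_nonzero by blast
  \<comment> \<open>Multiplication by the nonzero \<open>b - b'\<close> reaches every element, in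
    particular one of nonzero trace.\<close>
  moreover have "tr y = tr ((b - b') * (y / (b - b')))"
    using \<open>b \<noteq> b'\<close> by simp
  ultimately show False
    using assms by (simp only: left_diff_distrib fp_linear_diff[OF trace_linear]) simp
qed

text \<open>By nondegeneracy distinct \<open>b\<close> give distinct functionals, so the trace forms
  already exhaust the bound \<open>card_functionals_le\<close>.\<close>

lemma functional_is_trace:
  assumes "fp_linear f" and "range f \<subseteq> \<int>"
  shows "\<exists>b. \<forall>y. f y = tr (b * y)"
proof -
  let ?L = "{f :: 'b \<Rightarrow> 'b. fp_linear f \<and> range f \<subseteq> \<int>}"
  let ?T = "\<lambda>b y. tr (b * y)"
  have "fp_linear (?T b)" for b
    using trace_linear unfolding fp_linear_def by (metis distrib_left mult.left_commute)
  then have sub: "range ?T \<subseteq> ?L"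
    using trace_in_Ints by blast
  have "inj ?T"
    by (rule injI) (metis trace_form_nondegenerate)
  then have "card ?L \<le> card (range ?T)"
    using card_functionals_le[where 'b = 'b] by (simp add: card_image)
  with sub have "range ?T = ?L"
    by (intro card_seteq) auto
  with assms have "f \<in> range ?T"
    by blast
  then show ?thesis
    by auto
qed

text \<open>For each \<open>v\<close> the left side is a functional of \<open>y\<close>, hence a
  trace form; choice collects the representing elements, and nondegeneracy gives the uniqueness that
  \<open>THE\<close> requires.\<close>

lemma trace_adjoint:
  assumes "fp_linear (B0 :: 'b \<Rightarrow> 'b)"
  shows "tr (v * B0 y) = tr (trace_adjoint p m B0 v * y)"
proof -
  have "\<exists>b. \<forall>y. tr (v * B0 y) = tr (b * y)" for v
  proof (rule functional_is_trace)
    show "fp_linear (\<lambda>y. tr (v * B0 y))"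
      using trace_linear assms unfolding fp_linear_def by (metis distrib_left mult.left_commute)
  qed (auto simp: trace_in_Ints)
  then have "\<forall>v. \<exists>b. \<forall>y. tr (v * B0 y) = tr (b * y)"
    by blast
  from choice[OF this] obtain B' where B': "\<forall>v y. tr (v * B0 y) = tr (B' v * y)"
    by blast
  have "trace_adjoint p m B0 = B'"
    unfolding trace_adjoint_def
  proof (rule the_equality)
    show "\<forall>v y. tr (v * B0 y) = tr (B' v * y)"
      by (fact B')
  next
    fix B''
    assume B'': "\<forall>v y. tr (v * B0 y) = tr (B'' v * y)"
    show "B'' = B'"
      by (rule ext, rule trace_form_nondegenerate)
        (simp only: B'[rule_format, symmetric] B''[rule_format, symmetric])
  qed
  then show ?thesis
    using B' by simp
qed

text \<open>Since \<open>B0\<close> is onto, equal adjoint values at \<open>v\<close> and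
  \<open>w\<close> make their trace forms agree everywhere. Finiteness turns injectivity into
  bijectivity.\<close>

lemma bij_trace_adjoint:
  assumes "fp_linear (B0 :: 'b \<Rightarrow> 'b)" and "bij B0"
  shows "bij (trace_adjoint p m B0)"
proof -
  have "inj (trace_adjoint p m B0)"
  proof (rule injI, rule trace_form_nondegenerate)
    fix v w y
    assume eq: "trace_adjoint p m B0 v = trace_adjoint p m B0 w"
    obtain x where "y = B0 x"
      using assms(2) by (meson bij_pointE)
    then show "tr (v * y) = tr (w * y)"
      using eq by (simp add: trace_adjoint[OF assms(1)])
  qed
  then show ?thesis
    by (simp add: bij_def finite_UNIV_inj_surj)
qed

lemma trace_adjoint_zero:
  assumes "fp_linear (B0 :: 'b \<Rightarrow> 'b)"
  shows "trace_adjoint p m B0 0 = 0"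
  by (rule trace_form_nondegenerate) (simp flip: trace_adjoint[OF assms])

section \<open>Profiles of equivalent functions\<close>

lemma L_dev_EA:
  fixes F :: "'a::{field,finite} \<Rightarrow> 'b" and A :: "'a \<Rightarrow> 'a"
  assumes "bij A" and "fp_linear A0" and A: "\<And>x. A x = A0 x + a"
    and "fp_linear B0" and B: "\<And>y. B y = B0 y + b"
    and "fp_linear C0" and C: "\<And>x. C x = C0 x + c"
  shows "L_dev p n m (\<lambda>x. (B \<circ> F \<circ> A) x + C x) u v j =
    L_dev p n m F (A0 u) (trace_adjoint p m B0 v) (j - tr (v * C0 u))"
proof -
  let ?G = "\<lambda>x. (B \<circ> F \<circ> A) x + C x"
  have "A (x + u) = A x + A0 u" for x
    by (simp add: A fp_linear_add[OF assms(2)])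
  \<comment> \<open>The constants \<open>b\<close> and \<open>c\<close> cancel in the difference;
    \<open>a\<close> survives only inside \<open>A x\<close>.\<close>
  then have "derivative ?G u x = B0 (derivative F (A0 u) (A x)) + C0 u" for x
    by (simp add: derivative_def B C fp_linear_add[OF assms(6)] fp_linear_diff[OF assms(4)])
  then have "tr (v * derivative ?G u x) =
      tr (trace_adjoint p m B0 v * derivative F (A0 u) (A x)) + tr (v * C0 u)" for x
    by (simp add: distrib_left fp_linear_add[OF trace_linear] trace_adjoint[OF assms(4)])
  \<comment> \<open>The contribution of \<open>C\<close> moves to the level, and what remains is a
    preimage under the bijection \<open>A\<close>, so the count is unchanged.\<close>
  then have "{x. tr (v * derivative ?G u x) = j} =
      A -` {z. tr (trace_adjoint p m B0 v * derivative F (A0 u) z) = j - tr (v * C0 u)}"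
    by (auto simp: eq_diff_eq)
  moreover have "card (A -` S) = card S" for S
    using assms(1) by (simp add: bij_def card_vimage_inj)
  ultimately show ?thesis
    unfolding L_dev_def by metis
qed

text \<open>With \<open>C = 0\<close> the level shift is the trace of \<open>0\<close>, which
  vanishes.\<close>

lemma L_dev_affine:
  fixes F :: "'a::{field,finite} \<Rightarrow> 'b" and A :: "'a \<Rightarrow> 'a"
  assumes "bij A" and "fp_affine_with_linear_part A A0" and "fp_affine_with_linear_part B B0"
  shows "L_dev p n m (B \<circ> F \<circ> A) u v j = L_dev p n m F (A0 u) (trace_adjoint p m B0 v) j"
proof -
  obtain a b where "fp_linear A0" "\<And>x. A x = A0 x + a" "fp_linear B0" "\<And>x. B x = B0 x + b"
    using assms(2,3) unfolding fp_affine_with_linear_part_def by auto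
  moreover have "fp_linear (\<lambda>_ :: 'a. 0 :: 'b)"
    by (simp add: fp_linear_def)
  ultimately show ?thesis
    using L_dev_EA[of A A0 a B0 B b "\<lambda>_ :: 'a. 0" "\<lambda>_. 0" 0] assms(1)
      fp_linear_zero[OF trace_linear] by (simp add: o_def)
qed

lemma bij_betw_nonzero:
  assumes "bij f" and "f 0 = 0"
  shows "bij_betw f (UNIV - {0}) (UNIV - {0})"
  using bij_betw_DiffI[OF assms(1), of "{0}" "{0}"] assms(2) by (simp add: bij_betw_def)

lemma L_multiset_EA:
  fixes F G :: "'a::{field,finite} \<Rightarrow> 'b"
  assumes "EA_equivalent F G"
  shows "L_multiset p n m G = L_multiset p n m F"
proof -
  obtain A A0 a B B0 b C C0 c where
    A: "bij A" "fp_linear A0" "\<And>x. A x = A0 x + a" and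
    B: "bij B" "fp_linear B0" "\<And>y. B y = B0 y + b" and
    C: "fp_linear C0" "\<And>x. C x = C0 x + c" and
    G: "G = (\<lambda>x. (B \<circ> F \<circ> A) x + C x)"
  proof -
    obtain A B C where A: "fp_affine A" "bij A" and B: "fp_affine B" "bij B" and C: "fp_affine C"
      and G: "G = (\<lambda>x. (B \<circ> F \<circ> A) x + C x)"
      using assms unfolding EA_equivalent_def affine_permutation_def by blast
    obtain A0 a where A0: "fp_linear A0" "A = (\<lambda>x. A0 x + a)"
      using A(1) unfolding fp_affine_iff by blast
    obtain B0 b where B0: "fp_linear B0" "B = (\<lambda>x. B0 x + b)"
      using B(1) unfolding fp_affine_iff by blast
    obtain C0 c where C0: "fp_linear C0" "C = (\<lambda>x. C0 x + c)"
      using C unfolding fp_affine_iff by blast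
    show thesis
      by (rule that[OF A(2) A0(1) _ B(2) B0(1) _ C0(1) _ G]) (simp_all add: A0(2) B0(2) C0(2))
  qed
  let ?adj = "trace_adjoint p m B0"
  let ?X = "(UNIV - {0 :: 'a}) \<times> (UNIV - {0 :: 'b}) \<times> (\<int> :: 'b set)"
  \<comment> \<open>\<open>\<phi>\<close> sends an index for \<open>G\<close> to an index for
    \<open>F\<close> with the same deviation. For fixed masks it translates the prime subfield,
    since traces lie there.\<close>
  define \<phi> where "\<phi> = (\<lambda>(u, v, j). (A0 u, ?adj v, j - tr (v * C0 u)))"
  have A0: "bij_betw A0 (UNIV - {0}) (UNIV - {0})"
    by (intro bij_betw_nonzero bij_linear_part[OF A(1,3)] fp_linear_zero[OF A(2)])
  have adj: "bij_betw ?adj (UNIV - {0}) (UNIV - {0})"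
    by (intro bij_betw_nonzero bij_trace_adjoint trace_adjoint_zero B(2) bij_linear_part[OF B(1,3)])
  have "\<phi> ` ?X \<subseteq> ?X"
  proof (rule image_subsetI, elim SigmaE, hypsubst)
    fix u v j
    assume "u \<in> UNIV - {0::'a}" "v \<in> UNIV - {0::'b}" "j \<in> (\<int> :: 'b set)"
    then have "A0 u \<in> UNIV - {0}" "?adj v \<in> UNIV - {0}" "j - tr (v * C0 u) \<in> \<int>"
      using bij_betwE[OF A0] bij_betwE[OF adj] trace_in_Ints Ints_diff by blast+
    then show "\<phi> (u, v, j) \<in> ?X"
      unfolding \<phi>_def by simp
  qed
  moreover have inj: "inj_on \<phi> ?X"
  proof (rule inj_onI)
    fix s t
    assume st: "s \<in> ?X" "t \<in> ?X" and eq: "\<phi> s = \<phi> t"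
    obtain u v j u' v' j' where s: "s = (u, v, j)" and t: "t = (u', v', j')"
      by (metis prod_cases3)
    have "A0 u = A0 u'" "?adj v = ?adj v'"
      using eq by (simp_all add: s t \<phi>_def)
    moreover have "u \<in> UNIV - {0}" "u' \<in> UNIV - {0}" "v \<in> UNIV - {0}" "v' \<in> UNIV - {0}"
      using st by (simp_all add: s t)
    ultimately have "u = u'" "v = v'"
      using bij_betw_imp_inj_on[OF A0] bij_betw_imp_inj_on[OF adj] by (blast dest: inj_onD)+
    \<comment> \<open>With equal masks both levels are shifted by the same amount, so they can be
      compared.\<close>
    with eq show "s = t"
      by (simp add: s t \<phi>_def)
  qed
  \<comment> \<open>An injective self-map of a finite set is onto.\<close>
  ultimately have \<phi>: "\<phi> ` ?X = ?X"
    by (intro card_seteq) (auto simp: card_image)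
  let ?LF = "\<lambda>(u, v, j). L_dev p n m F u v j"
  have "L_dev p n m G u v j = L_dev p n m F (A0 u) (?adj v) (j - tr (v * C0 u))" for u v j
    unfolding G by (rule L_dev_EA[OF A B(2,3) C])
  then have "(\<lambda>(u, v, j). L_dev p n m G u v j) = ?LF \<circ> \<phi>"
    by (simp add: fun_eq_iff \<phi>_def)
  then have "L_multiset p n m G = image_mset (?LF \<circ> \<phi>) (mset_set ?X)"
    by (simp only: L_multiset_def)
  also have "\<dots> = image_mset ?LF (image_mset \<phi> (mset_set ?X))"
    by (simp add: multiset.map_comp)
  also have "image_mset \<phi> (mset_set ?X) = mset_set ?X"
    by (simp add: image_mset_mset_set[OF inj] \<phi>)
  finally show ?thesis
    by (simp add: L_multiset_def)
qed

text \<open>Without a level shift, level \<open>0\<close> stays at \<open>0\<close>, and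
  \<open>A0\<close> paired with the adjoint permutes the nonzero masks; both maxima run over the
  same values.\<close>

lemma gamma_zero_max_affine:
  fixes F G :: "'a::{field,finite} \<Rightarrow> 'b"
  assumes "affine_equivalent F G"
  shows "gamma_zero_max p n m G = gamma_zero_max p n m F"
proof -
  obtain A B where A: "fp_affine A" "bij A" and B: "fp_affine B" "bij B" and G: "G = B \<circ> F \<circ> A"
    using assms unfolding affine_equivalent_def affine_permutation_def by blast
  obtain A0 a where A0: "fp_affine_with_linear_part A A0" "fp_linear A0" "\<forall>x. A x = A0 x + a"
    using A(1) unfolding fp_affine_def fp_affine_with_linear_part_def by blast
  obtain B0 b where B0: "fp_affine_with_linear_part B B0" "fp_linear B0" "\<forall>x. B x = B0 x + b"
    using B(1) unfolding fp_affine_def fp_affine_with_linear_part_def by blast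
  let ?adj = "trace_adjoint p m B0"
  let ?X = "(UNIV - {0 :: 'a}) \<times> (UNIV - {0 :: 'b})"
  have A0_img: "bij_betw A0 (UNIV - {0}) (UNIV - {0})"
    by (intro bij_betw_nonzero bij_linear_part[OF A(2) A0(3)[rule_format]] fp_linear_zero[OF A0(2)])
  have adj_img: "bij_betw ?adj (UNIV - {0}) (UNIV - {0})"
    by (intro bij_betw_nonzero bij_trace_adjoint trace_adjoint_zero B0(2)
        bij_linear_part[OF B(2) B0(3)[rule_format]])
  have img: "map_prod A0 ?adj ` ?X = ?X"
    by (rule map_prod_surj_on[OF bij_betw_imp_surj_on[OF A0_img] bij_betw_imp_surj_on[OF adj_img]])
  have "(\<lambda>(u, v). \<bar>L_dev p n m G u v 0\<bar>) =
      (\<lambda>(u, v). \<bar>L_dev p n m F u v 0\<bar>) \<circ> map_prod A0 ?adj"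
    unfolding G by (rule ext) (simp only: L_dev_affine[OF A(2) A0(1) B0(1)] comp_apply
        map_prod_simp case_prod_conv split_paired_all)
  then have "(\<lambda>(u, v). \<bar>L_dev p n m G u v 0\<bar>) ` ?X = (\<lambda>(u, v). \<bar>L_dev p n m F u v 0\<bar>) ` ?X"
    by (simp only: image_comp[symmetric] img)
  then show ?thesis
    by (simp only: gamma_zero_max_def)
qed

end

text \<open>This exhibits the maximum as a function of the multiset alone, so that it inherits
  EA-invariance.\<close>

lemma Gamma_max_eq_Max_L_multiset:
  fixes F :: "'a::{field,finite} \<Rightarrow> 'b::{field,finite}"
  shows "Gamma_max p n m F = Max (abs ` set_mset (L_multiset p n m F))"
proof -
  let ?X = "(UNIV - {0 :: 'a}) \<times> (UNIV - {0 :: 'b}) \<times> (\<int> :: 'b set)"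
  have "(\<lambda>(u, v, j). \<bar>L_dev p n m F u v j\<bar>) = abs \<circ> (\<lambda>(u, v, j). L_dev p n m F u v j)"
    by (rule ext) (simp only: split_paired_all case_prod_conv comp_apply)
  then show ?thesis
    unfolding Gamma_max_def L_multiset_def
    by (simp only: image_comp[symmetric] set_image_mset finite_set_mset_mset_set[OF finite])
qed

theorem corollary5p2:
  fixes p n m :: nat
    and F G :: "'a::{field,finite} \<Rightarrow> 'b::{field,finite}"
  assumes "prime p" and "n \<ge> 1" and "m \<ge> 1"
    and "CARD('a) = p ^ n" and "CARD('b) = p ^ m"
  shows "(EA_equivalent F G \<longrightarrow>
            L_multiset p n m G = L_multiset p n m F \<and> Gamma_max p n m G = Gamma_max p n m F) \<and>
         (\<forall>A B A0 B0.
            affine_permutation A \<and> affine_permutation B \<and>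
            fp_affine_with_linear_part A A0 \<and> fp_affine_with_linear_part B B0 \<and>
            G = B \<circ> F \<circ> A \<longrightarrow>
            (\<forall>u v. \<forall>j\<in>prime_subfield.
               L_dev p n m G u v j = L_dev p n m F (A0 u) (trace_adjoint p m B0 v) j)) \<and>
         (affine_equivalent F G \<longrightarrow> gamma_zero_max p n m G = gamma_zero_max p n m F)"
proof -
  interpret finite_field_trace p m "TYPE('b)"
    using assms by unfold_locales
  show ?thesis
  proof (intro conjI impI allI ballI)
    assume "EA_equivalent F G"
    then show "L_multiset p n m G = L_multiset p n m F"
      by (rule L_multiset_EA)
    then show "Gamma_max p n m G = Gamma_max p n m F"
      by (simp add: Gamma_max_eq_Max_L_multiset)
  next
    fix A B A0 B0 u v j
    assume *: "affine_permutation A \<and> affine_permutation B \<and>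
      fp_affine_with_linear_part A A0 \<and> fp_affine_with_linear_part B B0 \<and> G = B \<circ> F \<circ> A"
    then have "bij A" and linear: "fp_affine_with_linear_part A A0" "fp_affine_with_linear_part B B0"
      and G: "G = B \<circ> F \<circ> A"
      by (simp_all add: affine_permutation_def)
    show "L_dev p n m G u v j = L_dev p n m F (A0 u) (trace_adjoint p m B0 v) j"
      unfolding G using \<open>bij A\<close> linear by (rule L_dev_affine)
  next
    assume "affine_equivalent F G"
    then show "gamma_zero_max p n m G = gamma_zero_max p n m F"
      by (rule gamma_zero_max_affine)
  qed
qed

end
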